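(* Let $\alpha,\beta$ be relatively prime positive integers. For $\ell,r\ge 0$ let $B_{\ell,r}(x)=\sum_{k\ge 1} b_{\ell,r}(k)x^k$, where $b_{\ell,r}(k)$ is the number of paths in $\mathcal{L}_{\beta/\alpha}(k)$ having exactly $\ell$ left bounces and exactly $r$ right bounces on the line $y=\frac{\beta}{\alpha}x$, and let $G(x,s,t)=\sum_{\ell,r\ge 0}B_{\ell,r}(x)s^\ell t^r$. Then, as formal power series, $$G(x,s,t)=\frac{g(x)+(2-s-t)\big(g_{ee}(x)^{0}g_{en}(x)^2-g_{ee}(x)g_{nn}(x)\big)}{D(x,s,t)},$$ where $g_{ee}(x)^{0}=1$ and $$D(x,s,t)=1+(2-s-t)g_{en}(x)+(1-s)(1-t)\big(g_{en}(x)^2-g_{ee}(x)g_{nn}(x)\big).$$ Moreover, for $A,B\in\{E,N\}$ let $G_{ab}(x,s,t)$ denote the restriction of $G(x,s,t)$ to $AB$-paths, i.e. the coefficient of $s^\ell t^r x^k$ in $G_{ab}(x,s,t)$ is the number of $AB$-paths in $\mathcal{L}_{\beta/\alpha}(k)$ with exactly $\ell$ left bounces and $r$ right bounces. Then $$G_{ee}(x,s,t)=\frac{g_{ee}(x)}{D(x,s,t)},\qquad G_{nn}(x,s,t)=\frac{g_{nn}(x)}{D(x,s,t)},$$ $$G_{en}(x,s,t)=\frac{g_{en}(x)+(1-s)\big(g_{en}(x)^2-g_{ee}(x)g_{nn}(x)\big)}{D(x,s,t)},$$ $$G_{ne}(x,s,t)=\frac{g_{en}(x)+(1-t)\big(g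_{en}(x)^2-g_{ee}(x)g_{nn}(x)\big)}{D(x,s,t)}.$$
   Context: For a positive integer $k$, $\mathcal{L}_{\beta/\alpha}(k)$ is the set of lattice paths from $(0,0)$ to $(\alpha k,\beta k)$ with unit East steps $E=(1,0)$ and unit North steps $N=(0,1)$. For $A,B\in\{E,N\}$, an $AB$-path is such a path whose first step is $A$ and whose last step is $B$. A left bounce of a path is an interior vertex of the path that lies on the line $y=\frac{\beta}{\alpha}x$ (hence is a point $(\alpha i,\beta i)$ with $0<i<k$) at which the path arrives by an $E$-step and leaves by an $N$-step; a right bounce is such a vertex at which the path arrives by an $N$-step and leaves by an $E$-step. Generating functions of all paths: $g(x)=\sum_{k\ge1}\binom{(\alpha+\beta)k}{\alpha k}x^k$ counts all paths in $\mathcal{L}_{\beta/\alpha}(k)$, and $g_{ab}(x)$ counts $AB$-paths: $g_{ee}(x)=\sum_{k\ge1}\binom{(\alpha+\beta)k-2}{\alpha k-2}x^k$, $g_{en}(x)=g_{ne}(x)=\sum_{k\ge1}\binom{(\alpha+\beta)k-2}{\alpha k-1}x^k$, $g_{nn}(x)=\sum_{k\ge1}\binom{(\alpha+\beta)k-2}{\alpha k}x^k$, with $\binom{n}{m}=0$ if $m<0$ or $m>n$. *)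

theory Defs
  imports "HOL-Computational_Algebra.Formal_Power_Series"
begin

datatype step = E | N

text \<open>A lattice path starting at the origin is encoded by its list of steps;
  \<open>vertex w i\<close> is the point reached after the first \<open>i\<close> steps.\<close>

definition vertex :: "step list \<Rightarrow> nat \<Rightarrow> nat \<times> nat" where
  "vertex w i = (count_list (take i w) E, count_list (take i w) N)"

definition lattice_paths :: "nat \<Rightarrow> nat \<Rightarrow> nat \<Rightarrow> step list set" where
  "lattice_paths \<alpha> \<beta> k = {w. vertex w (length w) = (\<alpha> * k, \<beta> * k)}"

definition AB_paths :: "nat \<Rightarrow> nat \<Rightarrow> step \<Rightarrow> step \<Rightarrow> nat \<Rightarrow> step list set" where
  "AB_paths \<alpha> \<beta> A B k = {w \<in> lattice_paths \<alpha> \<beta> k. w \<noteq> [] \<and> hd w = A \<and> last w = B}"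

text \<open>The line \<open>y = (\<beta>/\<alpha>) x\<close>, with the denominator cleared (\<open>\<alpha> > 0\<close>).\<close>

definition on_line :: "nat \<Rightarrow> nat \<Rightarrow> nat \<times> nat \<Rightarrow> bool" where
  "on_line \<alpha> \<beta> p \<longleftrightarrow> \<alpha> * snd p = \<beta> * fst p"

text \<open>The vertices of a path are pairwise distinct, so bounces are represented by their
  indices: \<open>w ! (i - 1)\<close> is the step arriving at \<open>vertex w i\<close>, and \<open>w ! i\<close> the step leaving it.\<close>

definition left_bounces :: "nat \<Rightarrow> nat \<Rightarrow> step list \<Rightarrow> nat set" where
  "left_bounces \<alpha> \<beta> w =
     {i. 0 < i \<and> i < length w \<and> on_line \<alpha> \<beta> (vertex w i) \<and> w ! (i - 1) = E \<and> w ! i = N}"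

definition right_bounces :: "nat \<Rightarrow> nat \<Rightarrow> step list \<Rightarrow> nat set" where
  "right_bounces \<alpha> \<beta> w =
     {i. 0 < i \<and> i < length w \<and> on_line \<alpha> \<beta> (vertex w i) \<and> w ! (i - 1) = N \<and> w ! i = E}"

definition b_count :: "nat \<Rightarrow> nat \<Rightarrow> nat \<Rightarrow> nat \<Rightarrow> nat \<Rightarrow> nat" where
  "b_count \<alpha> \<beta> l r k = card {w \<in> lattice_paths \<alpha> \<beta> k.
     card (left_bounces \<alpha> \<beta> w) = l \<and> card (right_bounces \<alpha> \<beta> w) = r}"

definition b_count_AB :: "nat \<Rightarrow> nat \<Rightarrow> step \<Rightarrow> step \<Rightarrow> nat \<Rightarrow> nat \<Rightarrow> nat \<Rightarrow> nat" where
  "b_count_AB \<alpha> \<beta> A B l r k = card {w \<in> AB_paths \<alpha> \<beta> A B k.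
     card (left_bounces \<alpha> \<beta> w) = l \<and> card (right_bounces \<alpha> \<beta> w) = r}"

text \<open>\<open>\<Sum>k\<ge>1. a(k) x^k\<close>, over an arbitrary coefficient ring.\<close>

definition gf :: "(nat \<Rightarrow> nat) \<Rightarrow> 'a::semiring_1 fps" where
  "gf a = Abs_fps (\<lambda>k. if k = 0 then 0 else of_nat (a k))"

text \<open>Binomial coefficients with integer arguments that vanish for \<open>m < 0\<close> or \<open>m > n\<close>.
  Natural-number arguments would not do: \<open>\<alpha> * k - 2\<close> must be \<open>-1\<close>, not \<open>0\<close>,
  when \<open>\<alpha> * k = 1\<close>.\<close>

definition binom :: "int \<Rightarrow> int \<Rightarrow> nat" where
  "binom n m = (if m < 0 \<or> m > n then 0 else nat n choose nat m)"

definition g_all :: "nat \<Rightarrow> nat \<Rightarrow> 'a::semiring_1 fps" where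
  "g_all \<alpha> \<beta> = gf (\<lambda>k. ((\<alpha> + \<beta>) * k) choose (\<alpha> * k))"

definition g_ee :: "nat \<Rightarrow> nat \<Rightarrow> 'a::semiring_1 fps" where
  "g_ee \<alpha> \<beta> = gf (\<lambda>k. binom (int ((\<alpha> + \<beta>) * k) - 2) (int (\<alpha> * k) - 2))"

definition g_en :: "nat \<Rightarrow> nat \<Rightarrow> 'a::semiring_1 fps" where
  "g_en \<alpha> \<beta> = gf (\<lambda>k. binom (int ((\<alpha> + \<beta>) * k) - 2) (int (\<alpha> * k) - 1))"

definition g_nn :: "nat \<Rightarrow> nat \<Rightarrow> 'a::semiring_1 fps" where
  "g_nn \<alpha> \<beta> = gf (\<lambda>k. binom (int ((\<alpha> + \<beta>) * k) - 2) (int (\<alpha> * k)))"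

text \<open>Formal power series in \<open>x\<close>, \<open>s\<close>, \<open>t\<close> are series in \<open>x\<close> over the ring of series in \<open>s\<close>
  over the ring of series in \<open>t\<close>: the coefficient of \<open>x^k s^l t^r\<close> in \<open>f\<close> is
  \<open>fps_nth (fps_nth (fps_nth f k) l) r\<close>.
  Rational coefficients are used because the library's division of power series needs an
  inverse on the coefficients.\<close>

type_synonym fps3 = "rat fps fps fps"

definition s_var :: fps3 where
  "s_var = fps_const fps_X"

definition t_var :: fps3 where
  "t_var = fps_const (fps_const fps_X)"

definition B_series :: "nat \<Rightarrow> nat \<Rightarrow> nat \<Rightarrow> nat \<Rightarrow> rat fps" where
  "B_series \<alpha> \<beta> l r = gf (b_count \<alpha> \<beta> l r)"

definition G_series :: "nat \<Rightarrow> nat \<Rightarrow> fps3" where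
  "G_series \<alpha> \<beta> = Abs_fps (\<lambda>k. Abs_fps (\<lambda>l. Abs_fps (\<lambda>r. fps_nth (B_series \<alpha> \<beta> l r) k)))"

definition G_AB :: "nat \<Rightarrow> nat \<Rightarrow> step \<Rightarrow> step \<Rightarrow> fps3" where
  "G_AB \<alpha> \<beta> A B =
     Abs_fps (\<lambda>k. Abs_fps (\<lambda>l. Abs_fps (\<lambda>r. fps_nth (gf (b_count_AB \<alpha> \<beta> A B l r)) k)))"

definition D_series :: "nat \<Rightarrow> nat \<Rightarrow> fps3" where
  "D_series \<alpha> \<beta> = 1 + (2 - s_var - t_var) * g_en \<alpha> \<beta>
     + (1 - s_var) * (1 - t_var) * ((g_en \<alpha> \<beta>)\<^sup>2 - g_ee \<alpha> \<beta> * g_nn \<alpha> \<beta>)"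

text \<open>The coefficient ring \<open>rat fps fps\<close> is not a field, but division by \<open>D_series\<close> is genuine
  division, because its constant term in \<open>x\<close> is 1.\<close>

lemma D_series_nth_0: "fps_nth (D_series \<alpha> \<beta>) 0 = 1"
  by (simp add: D_series_def g_en_def g_ee_def g_nn_def gf_def power2_eq_square)

lemma divide_D_series: "f / D_series \<alpha> \<beta> = h \<longleftrightarrow> f = h * D_series \<alpha> \<beta>"
proof -
  let ?D = "D_series \<alpha> \<beta>"
  have inv1: "inverse (1 :: rat fps fps) = 1"
    by (intro fps_inverse_one' inverse_1)
  have "fps_nth ?D 0 * inverse (fps_nth ?D 0) = 1"
    by (simp only: D_series_nth_0 inv1 mult_1)
  from fps_right_inverse[OF this] have unit: "?D * inverse ?D = 1"
    by (subst fps_inverse_def)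
  have div: "f / ?D = f * inverse ?D"
    by (rule fps_divide_unit) (simp only: D_series_nth_0 one_neq_zero not_False_eq_True)
  show ?thesis
  proof
    assume "f / ?D = h"
    then have h: "h = f * inverse ?D"
      by (simp only: div)
    show "f = h * ?D"
      unfolding h by (simp only: mult.assoc mult.commute[of "inverse ?D" ?D] unit mult_1_right)
  next
    assume f: "f = h * ?D"
    show "f / ?D = h"
      unfolding div unfolding f by (simp only: mult.assoc unit mult_1_right)
  qed
qed

end

theory Submission
  imports Defs
begin

text \<open>
  Expanding \<open>s = 1 + (s - 1)\<close> and \<open>t = 1 + (t - 1)\<close> amounts to marking some of the bounces, a marked
  left bounce having weight \<open>s - 1\<close> and a marked right bounce weight \<open>t - 1\<close>. Cutting a path at its
  first marked bounce, which splits it into an arbitrary path and a path with marked bounces, gives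
  \<open>G\<^sub>A\<^sub>B = g\<^sub>A\<^sub>B + (s - 1) g\<^sub>A\<^sub>E G\<^sub>N\<^sub>B + (t - 1) g\<^sub>A\<^sub>N G\<^sub>E\<^sub>B\<close>.
  For fixed \<open>B\<close> this is a linear system in \<open>G\<^sub>E\<^sub>B\<close>, \<open>G\<^sub>N\<^sub>B\<close> whose determinant is \<open>D\<close>. Coprimality
  ensures that the only lattice points on the line are the \<open>(\<alpha> j, \<beta> j)\<close>.
\<close>

section \<open>Words and lattice paths\<close>

text \<open>The two letter counts vary independently here, so that an induction can strip one letter
  at a time and reach Pascal's rule.\<close>

definition words :: "nat \<Rightarrow> nat \<Rightarrow> step list set" where
  "words p q = {w. count_list w E = p \<and> count_list w N = q}"

lemma UNIV_step: "UNIV = {E, N}"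
  using step.exhaust by auto

lemma length_eq_count_step: "length w = count_list w E + count_list w N"
proof (induction w)
  case (Cons a w)
  then show ?case by (cases a) auto
qed simp

lemma finite_words: "finite (words p q)"
proof -
  have "finite {w :: step list. set w \<subseteq> UNIV \<and> length w = p + q}"
    by (rule finite_lists_length_eq) (simp add: UNIV_step)
  then show ?thesis
    by (rule finite_subset[rotated]) (auto simp: words_def length_eq_count_step)
qed

lemma words_Suc_Suc:
  "words (Suc p) (Suc q) = (#) E ` words p (Suc q) \<union> (#) N ` words (Suc p) q"
proof (intro equalityI subsetI)
  fix w assume w: "w \<in> words (Suc p) (Suc q)"
  then obtain a v where "w = a # v" by (cases w) (auto simp: words_def)
  with w show "w \<in> (#) E ` words p (Suc q) \<union> (#) N ` words (Suc p) q"
    by (cases a) (auto simp: words_def)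
qed (auto simp: words_def)

lemma words_0_right: "words p 0 = {replicate p E}"
proof -
  have "w = replicate p E" if "w \<in> words p 0" for w
    using that
  proof (induction w arbitrary: p)
    case (Cons a w)
    then show ?case by (cases a; cases p) (auto simp: words_def)
  qed (auto simp: words_def)
  moreover have "replicate p E \<in> words p 0"
    by (induction p) (auto simp: words_def)
  ultimately show ?thesis by blast
qed

lemma words_0_left: "words 0 q = {replicate q N}"
proof -
  have "w = replicate q N" if "w \<in> words 0 q" for w
    using that
  proof (induction w arbitrary: q)
    case (Cons a w)
    then show ?case by (cases a; cases q) (auto simp: words_def)
  qed (auto simp: words_def)
  moreover have "replicate q N \<in> words 0 q"
    by (induction q) (auto simp: words_def)
  ultimately show ?thesis by blast
qed

lemma card_words: "card (words p q) = (p + q) choose p"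
proof (induction "p + q" arbitrary: p q)
  case 0
  then show ?case by (simp add: words_0_right)
next
  case (Suc n)
  show ?case
  proof (cases "p = 0 \<or> q = 0")
    case True
    then show ?thesis by (auto simp: words_0_right words_0_left)
  next
    case False
    then obtain p' q' where pq: "p = Suc p'" "q = Suc q'"
      using not0_implies_Suc by blast
    have "card (words p q) = card (words p' q) + card (words p q')"
      unfolding pq words_Suc_Suc
      by (subst card_Un_disjoint) (auto simp: finite_words card_image)
    also have "\<dots> = ((p' + q) choose p') + ((p + q') choose p)"
      using Suc by (simp add: pq)
    finally show ?thesis by (simp add: pq)
  qed
qed

lemma lattice_paths_eq_words: "lattice_paths \<alpha> \<beta> k = words (\<alpha> * k) (\<beta> * k)"
  by (simp add: lattice_paths_def words_def vertex_def)

section \<open>Paths with prescribed first and last steps\<close>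

lemma finite_AB_paths: "finite (AB_paths \<alpha> \<beta> A B k)"
  unfolding AB_paths_def lattice_paths_eq_words by (simp add: finite_words)

lemma AB_paths_0: "AB_paths \<alpha> \<beta> A B 0 = {}"
  by (simp add: AB_paths_def lattice_paths_eq_words words_0_right)

text \<open>Positivity of \<open>\<alpha>\<close>, \<open>\<beta>\<close> and \<open>k\<close>
  forces a step of each kind, so the first and the last step sit at different positions.\<close>

lemma path_decomp:
  assumes "\<alpha> > 0" "\<beta> > 0" "k > 0" "w \<in> lattice_paths \<alpha> \<beta> k"
  obtains A B v where "w = A # v @ [B]"
proof -
  have pos: "\<alpha> * k > 0" "\<beta> * k > 0" using assms by auto
  have "length w = \<alpha> * k + \<beta> * k"
    using assms(4) by (simp add: lattice_paths_eq_words words_def length_eq_count_step)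
  with pos have "length w \<ge> 2" by linarith
  then obtain A u where u: "w = A # u" "u \<noteq> []"
    by (cases w; cases "tl w") auto
  then show thesis
    using that[of A "butlast u" "last u"] by simp
qed

lemma AB_paths_eq_image:
  assumes "\<alpha> > 0" "\<beta> > 0" "k > 0"
  shows "AB_paths \<alpha> \<beta> A B k = (\<lambda>v. A # v @ [B]) `
    {v. count_list (A # v @ [B]) E = \<alpha> * k \<and> count_list (A # v @ [B]) N = \<beta> * k}"
proof (intro equalityI subsetI)
  fix w assume w: "w \<in> AB_paths \<alpha> \<beta> A B k"
  then have "w \<in> lattice_paths \<alpha> \<beta> k" by (simp add: AB_paths_def)
  with assms obtain A' B' v where "w = A' # v @ [B']" by (rule path_decomp)
  with w show "w \<in> (\<lambda>v. A # v @ [B]) `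
    {v. count_list (A # v @ [B]) E = \<alpha> * k \<and> count_list (A # v @ [B]) N = \<beta> * k}"
    by (auto simp: AB_paths_def lattice_paths_eq_words words_def)
qed (auto simp: AB_paths_def lattice_paths_eq_words words_def)

lemma card_AB_paths:
  assumes "\<alpha> > 0" "\<beta> > 0" "k > 0"
  shows "card (AB_paths \<alpha> \<beta> A B k) =
    card {v. count_list (A # v @ [B]) E = \<alpha> * k \<and> count_list (A # v @ [B]) N = \<beta> * k}"
  unfolding AB_paths_eq_image[OF assms] by (rule card_image) (auto simp: inj_on_def)

lemma card_AB_paths_binom:
  assumes "\<alpha> > 0" "\<beta> > 0" "k > 0"
  shows "card (AB_paths \<alpha> \<beta> E E k) = binom (int ((\<alpha> + \<beta>) * k) - 2) (int (\<alpha> * k) - 2)"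
    and "card (AB_paths \<alpha> \<beta> E N k) = binom (int ((\<alpha> + \<beta>) * k) - 2) (int (\<alpha> * k) - 1)"
    and "card (AB_paths \<alpha> \<beta> N E k) = binom (int ((\<alpha> + \<beta>) * k) - 2) (int (\<alpha> * k) - 1)"
    and "card (AB_paths \<alpha> \<beta> N N k) = binom (int ((\<alpha> + \<beta>) * k) - 2) (int (\<alpha> * k))"
proof -
  have "\<alpha> * k > 0" "\<beta> * k > 0" using assms by auto
  then obtain p q where p: "\<alpha> * k = Suc p" and q: "\<beta> * k = Suc q"
    using gr0_implies_Suc by meson
  have sum: "(\<alpha> + \<beta>) * k = p + q + 2"
    using p q by (simp add: distrib_right)
  have "card (AB_paths \<alpha> \<beta> E N k) = (p + q) choose p"
    "card (AB_paths \<alpha> \<beta> N E k) = (p + q) choose p"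
    by (simp_all add: card_AB_paths[OF assms] p q flip: card_words words_def)
  then show "card (AB_paths \<alpha> \<beta> E N k) = binom (int ((\<alpha> + \<beta>) * k) - 2) (int (\<alpha> * k) - 1)"
    and "card (AB_paths \<alpha> \<beta> N E k) = binom (int ((\<alpha> + \<beta>) * k) - 2) (int (\<alpha> * k) - 1)"
    unfolding sum p by (simp_all add: binom_def nat_int_add)
  show "card (AB_paths \<alpha> \<beta> E E k) = binom (int ((\<alpha> + \<beta>) * k) - 2) (int (\<alpha> * k) - 2)"
  proof (cases p)
    \<comment> \<open>With \<open>\<alpha> * k = 1\<close>, the only East step cannot be both first
      and last beside a North step; the lower index -1 makes \<open>binom\<close> vanish
      too.\<close>
    case 0
    then show ?thesis by (simp add: card_AB_paths[OF assms] p q binom_def)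
  next
    case (Suc p')
    then have "card (AB_paths \<alpha> \<beta> E E k) = card (words p' (Suc q))"
      by (simp add: card_AB_paths[OF assms] p q words_def)
    then show ?thesis
      unfolding sum p Suc card_words by (simp add: binom_def nat_add_distrib)
  qed
  show "card (AB_paths \<alpha> \<beta> N N k) = binom (int ((\<alpha> + \<beta>) * k) - 2) (int (\<alpha> * k))"
  proof (cases q)
    \<comment> \<open>With \<open>\<beta> * k = 1\<close> there is no second North step;
      correspondingly \<open>\<alpha> * k\<close> exceeds the upper index by one.\<close>
    case 0
    then show ?thesis
      unfolding sum by (simp add: card_AB_paths[OF assms] p q binom_def)
  next
    case (Suc q')
    then have "card (AB_paths \<alpha> \<beta> N N k) = card (words (Suc p) q')"
      by (simp add: card_AB_paths[OF assms] p q words_def)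
    then show ?thesis
      unfolding sum p Suc card_words by (simp add: binom_def nat_add_distrib)
  qed
qed

text \<open>Indexing by steps lets one recursion cover all four binomial series. Starting at
  \<open>k = 0\<close> is harmless, as the empty path has no first step.\<close>

definition g_AB :: "nat \<Rightarrow> nat \<Rightarrow> step \<Rightarrow> step \<Rightarrow> 'a::semiring_1 fps" where
  "g_AB \<alpha> \<beta> A B = Abs_fps (\<lambda>k. of_nat (card (AB_paths \<alpha> \<beta> A B k)))"

lemma g_AB_eq:
  assumes "\<alpha> > 0" "\<beta> > 0"
  shows "g_AB \<alpha> \<beta> E E = g_ee \<alpha> \<beta>" "g_AB \<alpha> \<beta> E N = g_en \<alpha> \<beta>"
    "g_AB \<alpha> \<beta> N E = g_en \<alpha> \<beta>" "g_AB \<alpha> \<beta> N N = g_nn \<alpha> \<beta>"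
  by (rule fps_ext;
      auto simp: g_AB_def g_ee_def g_en_def g_nn_def gf_def AB_paths_0 card_AB_paths_binom[OF assms])+

text \<open>\<open>P\<close> stays free for two uses: it is trivial for \<open>g_all\<close> and
  fixes the bounce numbers for \<open>G_series\<close>.\<close>

lemma card_lattice_paths_split:
  assumes "\<alpha> > 0" "\<beta> > 0" "k > 0"
  shows "card {w \<in> lattice_paths \<alpha> \<beta> k. P w} =
    card {w \<in> AB_paths \<alpha> \<beta> E E k. P w} + card {w \<in> AB_paths \<alpha> \<beta> E N k. P w} +
    card {w \<in> AB_paths \<alpha> \<beta> N E k. P w} + card {w \<in> AB_paths \<alpha> \<beta> N N k. P w}"
proof -
  let ?S = "\<lambda>A B. {w \<in> AB_paths \<alpha> \<beta> A B k. P w}"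
  have ne: "w \<noteq> []" if "w \<in> lattice_paths \<alpha> \<beta> k" for w
    using path_decomp[OF assms that] by blast
  have "{w \<in> lattice_paths \<alpha> \<beta> k. P w} = ?S E E \<union> ?S E N \<union> ?S N E \<union> ?S N N"
    using ne by (auto simp: AB_paths_def) (metis step.exhaust)+
  moreover have "finite (?S A B)" for A B
    by (simp add: finite_AB_paths)
  moreover have "?S E E \<inter> ?S E N = {}" "(?S E E \<union> ?S E N) \<inter> ?S N E = {}"
    "(?S E E \<union> ?S E N \<union> ?S N E) \<inter> ?S N N = {}"
    by (auto simp: AB_paths_def)
  ultimately show ?thesis by (simp add: card_Un_disjoint)
qed

lemma g_all_eq:
  assumes "\<alpha> > 0" "\<beta> > 0"
  shows "(g_all \<alpha> \<beta> :: 'a::comm_ring_1 fps) = g_ee \<alpha> \<beta> + 2 * g_en \<alpha> \<beta> + g_nn \<alpha> \<beta>"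
proof -
  have "(g_all \<alpha> \<beta> :: 'a fps) =
    g_AB \<alpha> \<beta> E E + g_AB \<alpha> \<beta> E N + g_AB \<alpha> \<beta> N E + g_AB \<alpha> \<beta> N N"
  proof (rule fps_ext)
    fix k
    show "fps_nth (g_all \<alpha> \<beta> :: 'a fps) k =
      fps_nth (g_AB \<alpha> \<beta> E E + g_AB \<alpha> \<beta> E N + g_AB \<alpha> \<beta> N E + g_AB \<alpha> \<beta> N N) k"
    proof (cases "k = 0")
      case True
      then show ?thesis by (simp add: g_all_def gf_def g_AB_def AB_paths_0)
    next
      case False
      then have "((\<alpha> + \<beta>) * k choose (\<alpha> * k)) = card (lattice_paths \<alpha> \<beta> k)"
        by (simp add: lattice_paths_eq_words card_words distrib_right)
      then show ?thesis
        using card_lattice_paths_split[OF assms, of k "\<lambda>_. True"] False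
        by (simp add: g_all_def gf_def g_AB_def)
    qed
  qed
  then show ?thesis by (simp add: g_AB_eq[OF assms])
qed

lemma G_series_eq_sum:
  assumes "\<alpha> > 0" "\<beta> > 0"
  shows "G_series \<alpha> \<beta> = G_AB \<alpha> \<beta> E E + G_AB \<alpha> \<beta> E N + G_AB \<alpha> \<beta> N E + G_AB \<alpha> \<beta> N N"
proof (intro fps_ext)
  fix k l r
  show "fps_nth (fps_nth (fps_nth (G_series \<alpha> \<beta>) k) l) r = fps_nth (fps_nth (fps_nth
    (G_AB \<alpha> \<beta> E E + G_AB \<alpha> \<beta> E N + G_AB \<alpha> \<beta> N E + G_AB \<alpha> \<beta> N N) k) l) r"
    using card_lattice_paths_split[OF assms]
    by (simp add: G_series_def B_series_def G_AB_def gf_def b_count_def b_count_AB_def)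
qed

section \<open>Bounces\<close>

text \<open>Taking the two steps as parameters lets cutting and shifting be proved once for left and
  right bounces.\<close>

definition bounces :: "nat \<Rightarrow> nat \<Rightarrow> step \<Rightarrow> step \<Rightarrow> step list \<Rightarrow> nat set" where
  "bounces \<alpha> \<beta> P Q w =
     {i. 0 < i \<and> i < length w \<and> on_line \<alpha> \<beta> (vertex w i) \<and> w ! (i - 1) = P \<and> w ! i = Q}"

lemma left_bounces_eq: "left_bounces \<alpha> \<beta> = bounces \<alpha> \<beta> E N"
  by (simp add: fun_eq_iff left_bounces_def bounces_def)

lemma right_bounces_eq: "right_bounces \<alpha> \<beta> = bounces \<alpha> \<beta> N E"
  by (simp add: fun_eq_iff right_bounces_def bounces_def)

text \<open>Coprimality turns \<open>\<alpha> dvd \<beta> * x\<close> into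
  \<open>\<alpha> dvd x\<close>; cancelling \<open>\<alpha>\<close> in the line equation then yields
  \<open>y\<close>.\<close>

lemma on_line_iff:
  assumes "\<alpha> > 0" "coprime \<alpha> \<beta>"
  shows "on_line \<alpha> \<beta> (x, y) \<longleftrightarrow> (\<exists>j. x = \<alpha> * j \<and> y = \<beta> * j)"
proof
  assume line: "on_line \<alpha> \<beta> (x, y)"
  then have "\<alpha> dvd \<beta> * x" by (metis dvd_triv_left fst_conv on_line_def snd_conv)
  then have "\<alpha> dvd x" using assms(2) by (simp add: coprime_dvd_mult_right_iff)
  then obtain j where "x = \<alpha> * j" by blast
  with line assms(1) show "\<exists>j. x = \<alpha> * j \<and> y = \<beta> * j"
    by (auto simp: on_line_def)
qed (auto simp: on_line_def)

lemma length_in_bounces_append: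
  assumes "u \<in> AB_paths \<alpha> \<beta> A P i" "v \<in> AB_paths \<alpha> \<beta> Q B j"
  shows "length u \<in> bounces \<alpha> \<beta> P Q (u @ v)"
  using assms
  by (auto simp: bounces_def AB_paths_def lattice_paths_def vertex_def on_line_def nth_append
      last_conv_nth hd_conv_nth)

lemma append_in_AB_paths:
  assumes "u \<in> AB_paths \<alpha> \<beta> A P i" "v \<in> AB_paths \<alpha> \<beta> Q B j"
  shows "u @ v \<in> AB_paths \<alpha> \<beta> A B (i + j)"
  using assms
  by (auto simp: AB_paths_def lattice_paths_eq_words words_def distrib_left)

text \<open>A bounce is a point \<open>(\<alpha> * j, \<beta> * j)\<close>, so both pieces end on
  the line after translation. The East count is exported because it recovers \<open>j\<close> from
  the prefix.\<close>

lemma bounce_splits_path: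
  assumes "\<alpha> > 0" "coprime \<alpha> \<beta>"
    and w: "w \<in> AB_paths \<alpha> \<beta> A B k" and i: "i \<in> bounces \<alpha> \<beta> P Q w"
  obtains j where "j \<le> k" "count_list (take i w) E = \<alpha> * j"
    "take i w \<in> AB_paths \<alpha> \<beta> A P j" "drop i w \<in> AB_paths \<alpha> \<beta> Q B (k - j)"
proof -
  have i': "0 < i" "i < length w" "w ! (i - 1) = P" "w ! i = Q"
    using i by (auto simp: bounces_def)
  have "\<exists>j. count_list (take i w) E = \<alpha> * j \<and> count_list (take i w) N = \<beta> * j"
    using i on_line_iff[OF assms(1,2)] by (simp add: bounces_def vertex_def)
  then obtain j where j: "count_list (take i w) E = \<alpha> * j" "count_list (take i w) N = \<beta> * j"
    by blast
  have split: "count_list w X = count_list (take i w) X + count_list (drop i w) X" for X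
    by (metis append_take_drop_id count_list_append)
  have tot: "count_list w E = \<alpha> * k" "count_list w N = \<beta> * k"
    using w by (auto simp: AB_paths_def lattice_paths_eq_words words_def)
  have "\<alpha> * j \<le> \<alpha> * k" using split[of E] j tot by simp
  then have le: "j \<le> k" using assms(1) by simp
  have "take i w \<in> AB_paths \<alpha> \<beta> A P j"
    using i' j w by (auto simp: AB_paths_def lattice_paths_eq_words words_def last_conv_nth min_def)
  moreover have "drop i w \<in> AB_paths \<alpha> \<beta> Q B (k - j)"
    using i' j w split tot
    by (auto simp: AB_paths_def lattice_paths_eq_words words_def hd_drop_conv_nth diff_mult_distrib2)
  ultimately show thesis using that[of j] le j by blast
qed

text \<open>Translation by the endpoint of \<open>u\<close>, which lies on the line, preserves the
  line. The junction \<open>i = 0\<close> is excluded: its arriving step belongs to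
  \<open>u\<close>.\<close>

lemma bounces_append_shift:
  assumes u: "u \<in> lattice_paths \<alpha> \<beta> j" and i: "i > 0"
  shows "length u + i \<in> bounces \<alpha> \<beta> P Q (u @ v) \<longleftrightarrow> i \<in> bounces \<alpha> \<beta> P Q v"
proof -
  have "on_line \<alpha> \<beta> (vertex (u @ v) (length u + i)) \<longleftrightarrow> on_line \<alpha> \<beta> (vertex v i)"
    using u by (auto simp: on_line_def vertex_def lattice_paths_def distrib_left mult.left_commute)
  moreover have "(u @ v) ! (length u + i - 1) = v ! (i - 1)"
    using i by (auto simp: nth_append)
  ultimately show ?thesis using i by (simp add: bounces_def nth_append)
qed

section \<open>Weights of bounces and the first marked bounce\<close>

definition bounce_wt :: "nat \<Rightarrow> nat \<Rightarrow> 'a::comm_ring_1 \<Rightarrow> 'a \<Rightarrow> step list \<Rightarrow> nat \<Rightarrow> 'a" where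
  "bounce_wt \<alpha> \<beta> S T w i =
     (if i \<in> bounces \<alpha> \<beta> E N w then S else if i \<in> bounces \<alpha> \<beta> N E w then T else 1)"

text \<open>Position \<open>i\<close> itself is left out: if it is the first marked bounce, only
  later bounces remain free to be marked.\<close>

definition tail_wt :: "nat \<Rightarrow> nat \<Rightarrow> 'a::comm_ring_1 \<Rightarrow> 'a \<Rightarrow> step list \<Rightarrow> nat \<Rightarrow> 'a" where
  "tail_wt \<alpha> \<beta> S T w i = (\<Prod>j\<in>{i<..<length w}. bounce_wt \<alpha> \<beta> S T w j)"

definition path_wt :: "nat \<Rightarrow> nat \<Rightarrow> 'a::comm_ring_1 \<Rightarrow> 'a \<Rightarrow> step list \<Rightarrow> 'a" where
  "path_wt \<alpha> \<beta> S T w =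
     S ^ card (left_bounces \<alpha> \<beta> w) * T ^ card (right_bounces \<alpha> \<beta> w)"

lemma bounces_subset: "bounces \<alpha> \<beta> P Q w \<subseteq> {0<..<length w}"
  by (auto simp: bounces_def)

lemma finite_bounces: "finite (bounces \<alpha> \<beta> P Q w)"
  using bounces_subset by (rule finite_subset) simp

lemma bounces_disjoint: "bounces \<alpha> \<beta> E N w \<inter> bounces \<alpha> \<beta> N E w = {}"
  by (auto simp: bounces_def)

text \<open>Every bounce is an interior vertex, and all other interior vertices contribute the
  factor 1.\<close>

lemma tail_wt_0: "tail_wt \<alpha> \<beta> S T w 0 = path_wt \<alpha> \<beta> S T w"
proof -
  let ?L = "bounces \<alpha> \<beta> E N w" and ?R = "bounces \<alpha> \<beta> N E w"
  have "tail_wt \<alpha> \<beta> S T w 0 = (\<Prod>j\<in>?L \<union> ?R. bounce_wt \<alpha> \<beta> S T w j)"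
    unfolding tail_wt_def
    by (rule prod.mono_neutral_right) (use bounces_subset in \<open>auto simp: bounce_wt_def\<close>)
  also have "\<dots> = (\<Prod>j\<in>?L. bounce_wt \<alpha> \<beta> S T w j) * (\<Prod>j\<in>?R. bounce_wt \<alpha> \<beta> S T w j)"
    by (rule prod.union_disjoint) (simp_all add: finite_bounces bounces_disjoint)
  also have "(\<Prod>j\<in>?L. bounce_wt \<alpha> \<beta> S T w j) = (\<Prod>j\<in>?L. S)"
    by (rule prod.cong) (auto simp: bounce_wt_def)
  also have "(\<Prod>j\<in>?R. bounce_wt \<alpha> \<beta> S T w j) = (\<Prod>j\<in>?R. T)"
    by (rule prod.cong) (use bounces_disjoint in \<open>auto simp: bounce_wt_def\<close>)
  finally show ?thesis
    by (simp add: path_wt_def left_bounces_eq right_bounces_eq)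
qed

lemma tail_wt_append:
  assumes "u \<in> lattice_paths \<alpha> \<beta> j"
  shows "tail_wt \<alpha> \<beta> S T (u @ v) (length u) = path_wt \<alpha> \<beta> S T v"
proof -
  have "bounce_wt \<alpha> \<beta> S T v (i - length u) = bounce_wt \<alpha> \<beta> S T (u @ v) i"
    if "length u < i" for i
    using bounces_append_shift[OF assms, where i = "i - length u" and v = v] that
    by (simp add: bounce_wt_def)
  then have "tail_wt \<alpha> \<beta> S T (u @ v) (length u) = tail_wt \<alpha> \<beta> S T v 0"
    unfolding tail_wt_def
    by (intro prod.reindex_bij_witness[of _ "\<lambda>i. length u + i" "\<lambda>i. i - length u"]) auto
  then show ?thesis by (simp add: tail_wt_0)
qed

text \<open>The telescoping sum \<open>\<Sum>\<^sub>i (W\<^sub>i - W\<^sub>i\<^sub>+\<^sub>1)\<close> of tail weights: \<open>W\<^sub>i - W\<^sub>i\<^sub>+\<^sub>1\<close> vanishes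
  unless \<open>i + 1\<close> is a bounce. The term of a bounce collects the choices of marked bounces of
  which it is the first.\<close>

lemma path_wt_first_marked:
  fixes S T :: "'a::comm_ring_1"
  shows "path_wt \<alpha> \<beta> S T w = 1
    + (S - 1) * (\<Sum>i\<in>bounces \<alpha> \<beta> E N w. tail_wt \<alpha> \<beta> S T w i)
    + (T - 1) * (\<Sum>i\<in>bounces \<alpha> \<beta> N E w. tail_wt \<alpha> \<beta> S T w i)"
proof -
  let ?L = "bounces \<alpha> \<beta> E N w" and ?R = "bounces \<alpha> \<beta> N E w"
  let ?W = "tail_wt \<alpha> \<beta> S T w" and ?c = "bounce_wt \<alpha> \<beta> S T w"
  have step: "?W i - ?W (Suc i) = (?c (Suc i) - 1) * ?W (Suc i)" for i
  proof (cases "Suc i < length w")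
    case True
    then have "{i<..<length w} = insert (Suc i) {Suc i<..<length w}" by auto
    then show ?thesis by (simp add: tail_wt_def algebra_simps)
  next
    \<comment> \<open>Beyond the interior vertices both products are empty and the factor is 1, so
      both sides are 0.\<close>
    case False
    then have "{i<..<length w} = {}" "{Suc i<..<length w} = {}" by auto
    moreover have "?c (Suc i) = 1"
      using False by (simp add: bounce_wt_def bounces_def)
    ultimately show ?thesis by (simp add: tail_wt_def)
  qed
  have "?W 0 - ?W (length w) = (\<Sum>i<length w. ?W i - ?W (Suc i))"
    by (simp add: sum_lessThan_telescope')
  also have "\<dots> = (\<Sum>i<length w. (?c (Suc i) - 1) * ?W (Suc i))"
    by (simp only: step)
  \<comment> \<open>The shift brings in the index \<open>length w\<close>, which is no bounce and
    contributes 0.\<close>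
  also have "\<dots> = (\<Sum>i\<in>{0<..length w}. (?c i - 1) * ?W i)"
    by (rule sum.reindex_bij_witness[of _ "\<lambda>i. i - 1" Suc]) auto
  also have "\<dots> = (\<Sum>i\<in>?L \<union> ?R. (?c i - 1) * ?W i)"
    by (rule sum.mono_neutral_right) (auto simp: bounce_wt_def bounces_def)
  also have "\<dots> = (\<Sum>i\<in>?L. (?c i - 1) * ?W i) + (\<Sum>i\<in>?R. (?c i - 1) * ?W i)"
    by (rule sum.union_disjoint) (simp_all add: finite_bounces bounces_disjoint)
  also have "(\<Sum>i\<in>?L. (?c i - 1) * ?W i) = (S - 1) * (\<Sum>i\<in>?L. ?W i)"
    unfolding sum_distrib_left by (rule sum.cong) (auto simp: bounce_wt_def)
  also have "(\<Sum>i\<in>?R. (?c i - 1) * ?W i) = (T - 1) * (\<Sum>i\<in>?R. ?W i)"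
    unfolding sum_distrib_left
    by (rule sum.cong) (use bounces_disjoint in \<open>auto simp: bounce_wt_def\<close>)
  also have "?W (length w) = 1" by (simp add: tail_wt_def)
  finally show ?thesis by (simp add: tail_wt_0 algebra_simps)
qed

text \<open>Cutting at the chosen bounce is a bijection onto pairs of paths of total size
  \<open>k\<close>. The prefix carries no mark and is merely counted; the tail weight becomes the
  full weight of the suffix.\<close>

lemma sum_bounces_eq_convolution:
  fixes S T :: "'a::comm_ring_1"
  assumes "\<alpha> > 0" "coprime \<alpha> \<beta>"
  shows "(\<Sum>w\<in>AB_paths \<alpha> \<beta> A B k. \<Sum>i\<in>bounces \<alpha> \<beta> P Q w. tail_wt \<alpha> \<beta> S T w i) =
    (\<Sum>j=0..k. of_nat (card (AB_paths \<alpha> \<beta> A P j)) *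
      (\<Sum>v\<in>AB_paths \<alpha> \<beta> Q B (k - j). path_wt \<alpha> \<beta> S T v))"
proof -
  let ?Pairs = "SIGMA w:AB_paths \<alpha> \<beta> A B k. bounces \<alpha> \<beta> P Q w"
  let ?Triples = "SIGMA j:{0..k}. AB_paths \<alpha> \<beta> A P j \<times> AB_paths \<alpha> \<beta> Q B (k - j)"
  have "(\<Sum>w\<in>AB_paths \<alpha> \<beta> A B k. \<Sum>i\<in>bounces \<alpha> \<beta> P Q w. tail_wt \<alpha> \<beta> S T w i) =
    (\<Sum>(w, i)\<in>?Pairs. tail_wt \<alpha> \<beta> S T w i)"
    by (rule sum.Sigma) (simp_all add: finite_AB_paths finite_bounces)
  also have "\<dots> = (\<Sum>(j, u, v)\<in>?Triples. path_wt \<alpha> \<beta> S T v)"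
  \<comment> \<open>The prefix has \<open>\<alpha> * j\<close> East steps, so division by
    \<open>\<alpha>\<close> recovers its size \<open>j\<close>; the inverse map
    concatenates.\<close>
  proof (rule sum.reindex_bij_witness[of _ "\<lambda>(j, u, v). (u @ v, length u)"
        "\<lambda>(w, i). (count_list (take i w) E div \<alpha>, take i w, drop i w)"])
    fix a assume a: "a \<in> ?Pairs"
    then obtain w i where wi: "a = (w, i)" "w \<in> AB_paths \<alpha> \<beta> A B k" "i \<in> bounces \<alpha> \<beta> P Q w"
      by auto
    from assms wi(2,3) obtain j where j: "j \<le> k" "count_list (take i w) E = \<alpha> * j"
      "take i w \<in> AB_paths \<alpha> \<beta> A P j" "drop i w \<in> AB_paths \<alpha> \<beta> Q B (k - j)"
      by (rule bounce_splits_path)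
    have len: "length (take i w) = i"
      using wi(3) by (auto simp: bounces_def)
    show "(case case a of (w, i) \<Rightarrow> (count_list (take i w) E div \<alpha>, take i w, drop i w) of
        (j, u, v) \<Rightarrow> (u @ v, length u)) = a"
      using len by (simp add: wi)
    show "(case a of (w, i) \<Rightarrow> (count_list (take i w) E div \<alpha>, take i w, drop i w)) \<in> ?Triples"
      using j assms(1) by (simp add: wi)
    have "take i w \<in> lattice_paths \<alpha> \<beta> j"
      using j(3) by (simp add: AB_paths_def)
    from tail_wt_append[OF this, of S T "drop i w"] len
    show "(case case a of (w, i) \<Rightarrow> (count_list (take i w) E div \<alpha>, take i w, drop i w) of
        (j, u, v) \<Rightarrow> path_wt \<alpha> \<beta> S T v) = (case a of (w, i) \<Rightarrow> tail_wt \<alpha> \<beta> S T w i)"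
      by (simp add: wi)
  next
    fix b assume "b \<in> ?Triples"
    then obtain j u v where b: "b = (j, u, v)" "j \<le> k"
      "u \<in> AB_paths \<alpha> \<beta> A P j" "v \<in> AB_paths \<alpha> \<beta> Q B (k - j)"
      by auto
    have "count_list u E = \<alpha> * j"
      using b(3) by (simp add: AB_paths_def lattice_paths_eq_words words_def)
    then show "(case case b of (j, u, v) \<Rightarrow> (u @ v, length u) of
        (w, i) \<Rightarrow> (count_list (take i w) E div \<alpha>, take i w, drop i w)) = b"
      using assms(1) by (simp add: b)
    show "(case b of (j, u, v) \<Rightarrow> (u @ v, length u)) \<in> ?Pairs"
      using append_in_AB_paths[OF b(3,4)] length_in_bounces_append[OF b(3,4)] b(2) by (simp add: b(1))
  qed
  also have "\<dots> = (\<Sum>j=0..k. \<Sum>(u, v)\<in>AB_paths \<alpha> \<beta> A P j \<times> AB_paths \<alpha> \<beta> Q B (k - j).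
      path_wt \<alpha> \<beta> S T v)"
    by (subst sum.Sigma) (simp_all add: finite_AB_paths split_def)
  \<comment> \<open>The summand is independent of \<open>u\<close>, so summing over \<open>u\<close>
    yields a cardinality.\<close>
  also have "\<dots> = (\<Sum>j=0..k. of_nat (card (AB_paths \<alpha> \<beta> A P j)) *
      (\<Sum>v\<in>AB_paths \<alpha> \<beta> Q B (k - j). path_wt \<alpha> \<beta> S T v))"
    by (simp flip: sum.cartesian_product)
  finally show ?thesis .
qed

section \<open>Generating functions\<close>

text \<open>In \<open>rat fps fps\<close> the outer variable stands for \<open>s\<close> and the
  constant series \<open>fps_const fps_X\<close> for \<open>t\<close>.\<close>

lemma s_t_power_nth:
  "fps_nth (fps_nth ((fps_X :: rat fps fps) ^ m * fps_const fps_X ^ n) l) r =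
    (if m = l \<and> n = r then 1 else 0)"
proof -
  have "(fps_X :: rat fps fps) ^ m * fps_const fps_X ^ n = fps_const (fps_X ^ n) * fps_X ^ m"
    by (simp only: fps_const_power mult.commute)
  then have "fps_nth ((fps_X :: rat fps fps) ^ m * fps_const fps_X ^ n) l =
      fps_X ^ n * (if l = m then 1 else 0)"
    by (simp only: fps_mult_left_const_nth fps_X_power_nth)
  then show ?thesis
    by (cases "l = m") (auto simp: fps_X_power_nth)
qed

text \<open>Each path contributes one monomial in \<open>s\<close> and \<open>t\<close>, so reading
  off a coefficient counts the paths with the given bounce numbers.\<close>

lemma G_AB_nth:
  "fps_nth (G_AB \<alpha> \<beta> A B) k =
    (\<Sum>w\<in>AB_paths \<alpha> \<beta> A B k. path_wt \<alpha> \<beta> fps_X (fps_const fps_X) w)"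
proof (intro fps_ext)
  fix l r
  let ?P = "\<lambda>w. card (left_bounces \<alpha> \<beta> w) = l \<and> card (right_bounces \<alpha> \<beta> w) = r"
  have "fps_nth (fps_nth (\<Sum>w\<in>AB_paths \<alpha> \<beta> A B k. path_wt \<alpha> \<beta> fps_X (fps_const fps_X) w) l) r
      = (\<Sum>w\<in>AB_paths \<alpha> \<beta> A B k. if ?P w then 1 else 0 :: rat)"
    by (simp only: fps_sum_nth path_wt_def s_t_power_nth)
  also have "\<dots> = of_nat (card {w \<in> AB_paths \<alpha> \<beta> A B k. ?P w})"
    by (simp add: finite_AB_paths flip: sum.inter_filter)
  also have "\<dots> = fps_nth (fps_nth (fps_nth (G_AB \<alpha> \<beta> A B) k) l) r"
    by (simp add: G_AB_def gf_def b_count_AB_def AB_paths_0)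
  finally show "fps_nth (fps_nth (fps_nth (G_AB \<alpha> \<beta> A B) k) l) r =
    fps_nth (fps_nth (\<Sum>w\<in>AB_paths \<alpha> \<beta> A B k. path_wt \<alpha> \<beta> fps_X (fps_const fps_X) w) l) r" ..
qed

text \<open>The summand 1 of \<open>path_wt_first_marked\<close> counts unmarked paths. A left
  bounce ends the prefix with \<open>E\<close> and starts the suffix with \<open>N\<close>; a right
  bounce does the reverse.\<close>

lemma G_AB_first_marked:
  assumes "\<alpha> > 0" "coprime \<alpha> \<beta>"
  shows "G_AB \<alpha> \<beta> A B = g_AB \<alpha> \<beta> A B
    + (s_var - 1) * (g_AB \<alpha> \<beta> A E * G_AB \<alpha> \<beta> N B)
    + (t_var - 1) * (g_AB \<alpha> \<beta> A N * G_AB \<alpha> \<beta> E B)"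
proof (rule fps_ext)
  fix k
  let ?S = "fps_X :: rat fps fps" and ?T = "fps_const fps_X :: rat fps fps"
  let ?AB = "AB_paths \<alpha> \<beta> A B k"
  \<comment> \<open>Both factors are constant in \<open>x\<close>, hence act on each coefficient
    separately.\<close>
  have vars: "s_var - 1 = fps_const (?S - 1)" "t_var - 1 = fps_const (?T - 1)"
    by (simp_all add: s_var_def t_var_def flip: fps_const_1_eq_1 fps_const_sub)
  have "fps_nth (G_AB \<alpha> \<beta> A B) k = of_nat (card ?AB)
    + (?S - 1) * (\<Sum>w\<in>?AB. \<Sum>i\<in>bounces \<alpha> \<beta> E N w. tail_wt \<alpha> \<beta> ?S ?T w i)
    + (?T - 1) * (\<Sum>w\<in>?AB. \<Sum>i\<in>bounces \<alpha> \<beta> N E w. tail_wt \<alpha> \<beta> ?S ?T w i)"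
  proof -
    have "fps_nth (G_AB \<alpha> \<beta> A B) k = (\<Sum>w\<in>?AB. 1
      + (?S - 1) * (\<Sum>i\<in>bounces \<alpha> \<beta> E N w. tail_wt \<alpha> \<beta> ?S ?T w i)
      + (?T - 1) * (\<Sum>i\<in>bounces \<alpha> \<beta> N E w. tail_wt \<alpha> \<beta> ?S ?T w i))"
      unfolding G_AB_nth by (intro sum.cong refl path_wt_first_marked)
    then show ?thesis
      by (simp only: sum.distrib sum_distrib_left sum_constant mult_1_right)
  qed
  also have "\<dots> = fps_nth (g_AB \<alpha> \<beta> A B
    + (s_var - 1) * (g_AB \<alpha> \<beta> A E * G_AB \<alpha> \<beta> N B)
    + (t_var - 1) * (g_AB \<alpha> \<beta> A N * G_AB \<alpha> \<beta> E B)) k"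
    unfolding sum_bounces_eq_convolution[OF assms] vars
      fps_add_nth fps_mult_left_const_nth
    unfolding fps_mult_nth G_AB_nth by (simp add: g_AB_def)
  finally show "fps_nth (G_AB \<alpha> \<beta> A B) k = fps_nth (g_AB \<alpha> \<beta> A B
    + (s_var - 1) * (g_AB \<alpha> \<beta> A E * G_AB \<alpha> \<beta> N B)
    + (t_var - 1) * (g_AB \<alpha> \<beta> A N * G_AB \<alpha> \<beta> E B)) k" .
qed

text \<open>\<open>X\<close> and \<open>Y\<close> stand for the series of paths starting with
  \<open>E\<close> and \<open>N\<close>; the common last step enters only through \<open>p\<close>
  and \<open>q\<close>. Elimination by multiplication avoids division in the ring.\<close>

lemma cramer_2x2:
  fixes X Y :: "'a::comm_ring_1"
  assumes X: "X = p + (s - 1) * (ee * Y) + (t - 1) * (en * X)"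
    and Y: "Y = q + (s - 1) * (en * Y) + (t - 1) * (nn * X)"
    and D: "D = 1 + (2 - s - t) * en + (1 - s) * (1 - t) * (en\<^sup>2 - ee * nn)"
  shows "X * D = p + (1 - s) * (en * p - ee * q)"
    and "Y * D = q + (1 - t) * (en * q - nn * p)"
proof -
  let ?u = "1 + (1 - s) * en" and ?v = "1 + (1 - t) * en"
  have "X * ?v = X - (t - 1) * (en * X)" by (simp add: algebra_simps)
  \<comment> \<open>Moving the subtracted term across gives exactly the hypothesis, without
    rewriting by an equation that has \<open>X\<close> on both sides.\<close>
  also have "\<dots> = p + (s - 1) * (ee * Y)" unfolding diff_eq_eq by (rule X)
  finally have X': "X * ?v = p + (s - 1) * (ee * Y)" .
  have "Y * ?u = Y - (s - 1) * (en * Y)" by (simp add: algebra_simps)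
  also have "\<dots> = q + (t - 1) * (nn * X)"
    unfolding diff_eq_eq by (rule trans[OF Y]) (simp only: ac_simps)
  finally have Y': "Y * ?u = q + (t - 1) * (nn * X)" .
  \<comment> \<open>\<open>D\<close> is the determinant of the system with diagonal entries
    \<open>?v\<close>, \<open>?u\<close> and off-diagonal entries \<open>(1 - s) * ee\<close>,
    \<open>(1 - t) * nn\<close>.\<close>
  have D': "D = ?u * ?v - (1 - s) * (1 - t) * ee * nn"
    unfolding D by (simp add: algebra_simps power2_eq_square)
  have "X * D = (X * ?v) * ?u - (1 - s) * (1 - t) * ee * nn * X"
    unfolding D' by (simp add: algebra_simps)
  also have "\<dots> = p * ?u + (s - 1) * ee * (Y * ?u) - (1 - s) * (1 - t) * ee * nn * X"
    unfolding X' by (simp add: algebra_simps)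
  also have "\<dots> = p + (1 - s) * (en * p - ee * q)"
    unfolding Y' by (simp add: algebra_simps)
  finally show "X * D = p + (1 - s) * (en * p - ee * q)" .
  have "Y * D = (Y * ?u) * ?v - (1 - s) * (1 - t) * ee * nn * Y"
    unfolding D' by (simp add: algebra_simps)
  also have "\<dots> = q * ?v + (t - 1) * nn * (X * ?v) - (1 - s) * (1 - t) * ee * nn * Y"
    unfolding Y' by (simp add: algebra_simps)
  also have "\<dots> = q + (1 - t) * (en * q - nn * p)"
    unfolding X' by (simp add: algebra_simps)
  finally show "Y * D = q + (1 - t) * (en * q - nn * p)" .
qed

theorem theorem3p3:
  fixes \<alpha> \<beta> :: nat
  assumes "\<alpha> > 0" and "\<beta> > 0" and "coprime \<alpha> \<beta>"
  shows "G_series \<alpha> \<beta> =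
           (g_all \<alpha> \<beta> + (2 - s_var - t_var) *
              ((g_ee \<alpha> \<beta>) ^ 0 * (g_en \<alpha> \<beta>)\<^sup>2 - g_ee \<alpha> \<beta> * g_nn \<alpha> \<beta>)) / D_series \<alpha> \<beta> \<and>
         G_AB \<alpha> \<beta> E E = g_ee \<alpha> \<beta> / D_series \<alpha> \<beta> \<and>
         G_AB \<alpha> \<beta> N N = g_nn \<alpha> \<beta> / D_series \<alpha> \<beta> \<and>
         G_AB \<alpha> \<beta> E N =
           (g_en \<alpha> \<beta> + (1 - s_var) * ((g_en \<alpha> \<beta>)\<^sup>2 - g_ee \<alpha> \<beta> * g_nn \<alpha> \<beta>)) / D_series \<alpha> \<beta> \<and>
         G_AB \<alpha> \<beta> N E =
           (g_en \<alpha> \<beta> + (1 - t_var) * ((g_en \<alpha> \<beta>)\<^sup>2 - g_ee \<alpha> \<beta> * g_nn \<alpha> \<beta>)) / D_series \<alpha> \<beta>"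
proof -
  let ?D = "D_series \<alpha> \<beta>"
  note g = g_AB_eq[OF assms(1,2)]
  note rec = G_AB_first_marked[OF assms(1,3), unfolded g]
  \<comment> \<open>Last steps \<open>E\<close> and \<open>N\<close> give the same matrix, with
    right-hand sides \<open>(g_ee, g_en)\<close> and \<open>(g_en, g_nn)\<close>.\<close>
  note solE = cramer_2x2[OF rec[of E E, unfolded g] rec[of N E, unfolded g] D_series_def]
  note solN = cramer_2x2[OF rec[of E N, unfolded g] rec[of N N, unfolded g] D_series_def]
  \<comment> \<open>Here the correction term of Cramer's rule cancels, as it does for
    \<open>nn\<close> below.\<close>
  have ee: "G_AB \<alpha> \<beta> E E * ?D = g_ee \<alpha> \<beta>"
    unfolding solE(1) by (simp add: mult.commute)
  have ne: "G_AB \<alpha> \<beta> N E * ?D =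
      g_en \<alpha> \<beta> + (1 - t_var) * ((g_en \<alpha> \<beta>)\<^sup>2 - g_ee \<alpha> \<beta> * g_nn \<alpha> \<beta>)"
    unfolding solE(2) by (simp add: power2_eq_square mult.commute)
  have en: "G_AB \<alpha> \<beta> E N * ?D =
      g_en \<alpha> \<beta> + (1 - s_var) * ((g_en \<alpha> \<beta>)\<^sup>2 - g_ee \<alpha> \<beta> * g_nn \<alpha> \<beta>)"
    unfolding solN(1) by (simp add: power2_eq_square)
  have nn: "G_AB \<alpha> \<beta> N N * ?D = g_nn \<alpha> \<beta>"
    unfolding solN(2) by (simp add: mult.commute)
  \<comment> \<open>The numerators without corrections sum to \<open>g_all\<close>; the two
    corrections combine through \<open>(1 - s) + (1 - t) = 2 - s - t\<close>.\<close>
  have "G_series \<alpha> \<beta> * ?D = g_all \<alpha> \<beta> + (2 - s_var - t_var) *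
      ((g_ee \<alpha> \<beta>) ^ 0 * (g_en \<alpha> \<beta>)\<^sup>2 - g_ee \<alpha> \<beta> * g_nn \<alpha> \<beta>)"
    unfolding G_series_eq_sum[OF assms(1,2)] g_all_eq[OF assms(1,2)] distrib_right ee en ne nn
    by (simp add: algebra_simps)
  note eqs = this ee nn en ne
  show ?thesis
    by (intro conjI; rule divide_D_series[THEN iffD2, symmetric]; rule eqs[symmetric])
qed

end
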